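(* Let $n \ge 3$, let $G=C_n$ be the cycle of order $n$, and let $f_0: V(G_1)\to V(G_2)$ be a constant function. Then $\dim(C(C_n,f_0)) = 3$ if $n = 3$; $\dim(C(C_n,f_0)) = \left\lceil \frac{2n+3}{5}\right\rceil$ if $n$ is odd and $n \neq 3$; and $\dim(C(C_n,f_0)) = \left\lceil \frac{2n}{5}\right\rceil + 1$ if $n$ is even.
   Context: For a connected graph $H$, a set $S \subseteq V(H)$ is a resolving set if for every two distinct vertices $x,y$ of $H$ there is $s \in S$ with $d_H(x,s) \neq d_H(y,s)$; the metric dimension $\dim(H)$ is the minimum cardinality of a resolving set of $H$. Given a graph $G$, let $G_1$ and $G_2$ be disjoint copies of $G$ and let $f: V(G_1)\to V(G_2)$ be a function. The functigraph $C(G,f)$ is the graph with vertex set $V(G_1)\cup V(G_2)$ and edge set $E(G_1)\cup E(G_2)\cup\{uv \mid u \in V(G_1),\ v=f(u)\}$. *)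

theory Defs
  imports Complex_Main "HOL-Library.Extended_Nat" "HOL-Library.FuncSet"
begin

text \<open>Simple graphs: every edge is a two-element set of vertices.\<close>

record 'a graph =
  verts :: "'a set"
  edges :: "'a set set"

definition walk :: "'a graph \<Rightarrow> 'a \<Rightarrow> 'a list \<Rightarrow> 'a \<Rightarrow> bool" where
  "walk H u p v \<longleftrightarrow>
     p \<noteq> [] \<and> hd p = u \<and> last p = v \<and> set p \<subseteq> verts H \<and>
     (\<forall>i. Suc i < length p \<longrightarrow> {p ! i, p ! Suc i} \<in> edges H)"

text \<open>A walk is given by its list of vertices, so the number of its edges is one less than the
  length of the list. Vertices that no walk joins have distance \<open>\<infinity>\<close>; in a connected graph
  all distances are finite.\<close>

definition gdist :: "'a graph \<Rightarrow> 'a \<Rightarrow> 'a \<Rightarrow> enat" where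
  "gdist H u v = (INF p \<in> {p. walk H u p v}. enat (length p - 1))"

definition resolving_set :: "'a graph \<Rightarrow> 'a set \<Rightarrow> bool" where
  "resolving_set H S \<longleftrightarrow>
     S \<subseteq> verts H \<and>
     (\<forall>x\<in>verts H. \<forall>y\<in>verts H. x \<noteq> y \<longrightarrow> (\<exists>s\<in>S. gdist H x s \<noteq> gdist H y s))"

text \<open>Finiteness of the resolving set is required because \<^const>\<open>card\<close> is 0 on infinite sets. In a
  finite graph the minimum exists, since the whole vertex set is resolving.\<close>

definition metric_dim :: "'a graph \<Rightarrow> nat" where
  "metric_dim H = (LEAST k. \<exists>S. resolving_set H S \<and> finite S \<and> card S = k)"

text \<open>The \<open>Inl\<close> vertices form the copy \<open>G\<^sub>1\<close> and the \<open>Inr\<close> vertices the copy \<open>G\<^sub>2\<close>.\<close>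

definition functigraph :: "'a graph \<Rightarrow> ('a \<Rightarrow> 'a) \<Rightarrow> ('a + 'a) graph" where
  "functigraph G f =
     \<lparr> verts = Inl ` verts G \<union> Inr ` verts G,
       edges = (\<lambda>e. Inl ` e) ` edges G \<union> (\<lambda>e. Inr ` e) ` edges G
               \<union> {{Inl u, Inr (f u)} | u. u \<in> verts G} \<rparr>"

text \<open>This is the cycle \<open>C\<^sub>n\<close> for \<open>n \<ge> 3\<close> only.\<close>

definition cycle_graph :: "nat \<Rightarrow> nat graph" where
  "cycle_graph n = \<lparr> verts = {0..<n}, edges = {{i, Suc i mod n} | i. i < n} \<rparr>"

end

theory Submission
  imports Defs
begin

text \<open>
  Let \<open>c\<close> be the value of the constant function. The functigraph is a wheel with rim \<open>G\<^sub>1\<close> and hub \<open>c\<close>,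
  glued at the hub to the cycle \<open>G\<^sub>2\<close>. All rim vertices look alike from \<open>G\<^sub>2\<close>, and rim distances are
  \<open>0\<close>, \<open>1\<close> or \<open>2\<close> (via the hub), so a resolving set must meet the rim in a locating set \<open>S\<close>:
  the vertices outside \<open>S\<close> have pairwise distinct neighbourhoods in \<open>S\<close>. Counting gives \<open>2 * n \<le> 5 * card S + 2 * u\<close>, where \<open>u \<le> 1\<close> is
  the number of undominated vertices. From the rim, \<open>G\<^sub>2\<close> is seen only up to reflection in \<open>c\<close>,
  so at least one landmark of \<open>G\<^sub>2\<close> is needed, and a suitable one is enough. When \<open>n\<close> is even and there is a single landmark
  \<open>v\<close> in \<open>G\<^sub>2\<close>, the neighbour of \<open>c\<close> pointing away from \<open>v\<close> has the same distances as an undominated rim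
  vertex, so \<open>S\<close> must be dominating; when \<open>n\<close> is odd, a vertex \<open>v\<close> at maximal distance from \<open>c\<close>
  avoids this. Optimal locating sets are made of the residues \<open>1\<close> and \<open>3\<close> modulo \<open>5\<close>, adjusted at the
  end of the cycle.
\<close>

section \<open>Distances from a potential function\<close>

lemma nat_all_iff: "(\<forall>i. P i) \<longleftrightarrow> P 0 \<and> (\<forall>i. P (Suc i))"
  by (metis not0_implies_Suc)

lemma walk_singleton_iff: "walk H u [a] v \<longleftrightarrow> a = u \<and> a = v \<and> a \<in> verts H"
  by (auto simp: walk_def)

lemma walk_Cons_iff:
  "walk H u (a # b # q) v \<longleftrightarrow> a = u \<and> a \<in> verts H \<and> {a, b} \<in> edges H \<and> walk H b (b # q) v"
proof -
  have "(\<forall>i. Suc i < length (a # b # q) \<longrightarrow> {(a # b # q) ! i, (a # b # q) ! Suc i} \<in> edges H) \<longleftrightarrow>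
      {a, b} \<in> edges H \<and>
      (\<forall>i. Suc i < length (b # q) \<longrightarrow> {(b # q) ! i, (b # q) ! Suc i} \<in> edges H)" (is "?l \<longleftrightarrow> ?r")
    using nat_all_iff[of "\<lambda>i. Suc i < length (a # b # q) \<longrightarrow>
      {(a # b # q) ! i, (a # b # q) ! Suc i} \<in> edges H"] by simp
  then have "walk H u (a # b # q) v \<longleftrightarrow> a # b # q \<noteq> [] \<and> hd (a # b # q) = u \<and>
      last (a # b # q) = v \<and> set (a # b # q) \<subseteq> verts H \<and> ?r"
    unfolding walk_def by (simp only:)
  also have "\<dots> \<longleftrightarrow> a = u \<and> a \<in> verts H \<and> {a, b} \<in> edges H \<and> walk H b (b # q) v"
    unfolding walk_def by (simp del: length_Cons nth_Cons_Suc) blast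
  finally show ?thesis .
qed

text \<open>A potential that rises by at most one per edge bounds every walk to \<open>s\<close>
  from below; following ever smaller potential from \<open>u\<close> gives a walk with exactly
  \<open>D u\<close> edges. Distances are thus obtained by guessing a formula and checking it
  locally.\<close>

lemma gdist_eqI:
  fixes D :: "'a \<Rightarrow> nat"
  assumes zero: "D s = 0"
    and step: "\<And>u v. {u, v} \<in> edges H \<Longrightarrow> D u \<le> Suc (D v)"
    and descent: "\<And>u. u \<in> verts H \<Longrightarrow> u \<noteq> s \<Longrightarrow> \<exists>v\<in>verts H. {u, v} \<in> edges H \<and> D u = Suc (D v)"
    and u: "u \<in> verts H"
  shows "gdist H u s = enat (D u)"
proof -
  have lower: "D u \<le> length p - 1" if "walk H u p s" for u p
    using that
  proof (induction p arbitrary: u)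
    case (Cons a p)
    show ?case
    proof (cases p)
      case Nil
      with Cons.prems zero show ?thesis by (auto simp: walk_singleton_iff)
    next
      case p: (Cons b q)
      with Cons.prems have "a = u" "{a, b} \<in> edges H" "walk H b p s"
        by (auto simp: walk_Cons_iff)
      with Cons.IH[of b] step[of a b] p show ?thesis by simp
    qed
  qed (simp add: walk_def)
  have upper: "\<exists>p. walk H u p s \<and> length p = Suc (D u)" if "u \<in> verts H" for u
    using that
  proof (induction "D u" arbitrary: u rule: less_induct)
    case less
    show ?case
    proof (cases "u = s")
      case True
      with zero less.prems show ?thesis by (intro exI[of _ "[s]"]) (simp add: walk_singleton_iff)
    next
      case False
      then obtain v where v: "v \<in> verts H" "{u, v} \<in> edges H" "D u = Suc (D v)"
        using descent less.prems by blast
      then obtain p where p: "walk H v p s" "length p = Suc (D v)"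
        using less.hyps[of v] by auto
      then obtain q where "p = v # q" by (cases p) (auto simp: walk_def)
      with p v less.prems have "walk H u (u # p) s" by (simp add: walk_Cons_iff)
      with p(2) v(3) show ?thesis by (intro exI[of _ "u # p"]) simp
    qed
  qed
  from upper[OF u] obtain p where p: "walk H u p s" "length p = Suc (D u)" by blast
  show ?thesis
    unfolding gdist_def
  proof (rule antisym)
    show "(INF p \<in> {p. walk H u p s}. enat (length p - 1)) \<le> enat (D u)"
      using p by (intro INF_lower2[of p]) auto
    show "enat (D u) \<le> (INF p \<in> {p. walk H u p s}. enat (length p - 1))"
      using lower by (intro INF_greatest) auto
  qed
qed

section \<open>Resolving sets and the metric dimension\<close>

lemma resolving_setD:
  "resolving_set H T \<Longrightarrow> p \<in> verts H \<Longrightarrow> q \<in> verts H \<Longrightarrow> p \<noteq> q \<Longrightarrow>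
    \<exists>t\<in>T. gdist H p t \<noteq> gdist H q t"
  by (simp add: resolving_set_def)

lemma metric_dim_le:
  assumes "resolving_set H S" "finite S"
  shows "metric_dim H \<le> card S"
  unfolding metric_dim_def using assms by (intro Least_le) blast

text \<open>A finite resolving set has to be supplied: \<open>LEAST\<close> over an unsatisfiable
  predicate carries no information.\<close>

lemma metric_dim_ge:
  assumes "resolving_set H S" "finite S"
    and "\<And>S. resolving_set H S \<Longrightarrow> finite S \<Longrightarrow> k \<le> card S"
  shows "k \<le> metric_dim H"
proof -
  have "\<exists>T. resolving_set H T \<and> finite T \<and> card T = metric_dim H"
    unfolding metric_dim_def by (rule LeastI_ex) (use assms(1,2) in blast)
  then obtain T where "resolving_set H T" "finite T" "card T = metric_dim H" by (elim exE conjE)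
  with assms(3)[of T] show ?thesis by simp
qed

section \<open>Cycles\<close>

text \<open>Free of \<open>mod\<close>, so that case splits and linear arithmetic decide it; the
  last two disjuncts are the wrap-around edge. The bounds \<open>x < n\<close> and
  \<open>y < n\<close> are left to the context.\<close>

definition cyc_adj :: "nat \<Rightarrow> nat \<Rightarrow> nat \<Rightarrow> bool" where
  "cyc_adj n x y \<longleftrightarrow> y = Suc x \<or> x = Suc y \<or> x = 0 \<and> Suc y = n \<or> y = 0 \<and> Suc x = n"

definition cyc_dist :: "nat \<Rightarrow> nat \<Rightarrow> nat \<Rightarrow> nat" where
  "cyc_dist n x y = min (max x y - min x y) (n - (max x y - min x y))"

lemma cycle_edges_iff:
  assumes "n \<ge> 3"
  shows "{x, y} \<in> edges (cycle_graph n) \<longleftrightarrow> x < n \<and> y < n \<and> cyc_adj n x y"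
proof -
  have *: "Suc i mod n = (if Suc i = n then 0 else Suc i)" if "i < n" for i
    using that by auto
  have "{x, y} \<in> edges (cycle_graph n) \<longleftrightarrow>
      (\<exists>i<n. x = i \<and> y = Suc i mod n \<or> y = i \<and> x = Suc i mod n)"
    by (auto simp: cycle_graph_def doubleton_eq_iff)
  also have "\<dots> \<longleftrightarrow> x < n \<and> y < n \<and> cyc_adj n x y"
    using assms * unfolding cyc_adj_def by (auto split: if_splits)
  finally show ?thesis .
qed

lemma cyc_dist_self [simp]: "cyc_dist n x x = 0"
  by (simp add: cyc_dist_def)

lemma cyc_dist_if:
  "cyc_dist n x y = (if x \<le> y then if 2 * (y - x) \<le> n then y - x else n - (y - x)
     else if 2 * (x - y) \<le> n then x - y else n - (x - y))"
  by (auto simp: cyc_dist_def)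

lemma cyc_dist_eq_0_iff: "x < n \<Longrightarrow> y < n \<Longrightarrow> cyc_dist n x y = 0 \<longleftrightarrow> x = y"
  by (auto simp: cyc_dist_if)

lemma cyc_dist_step:
  assumes "cyc_adj n x y" "x < n" "y < n" "v < n"
  shows "cyc_dist n x v \<le> Suc (cyc_dist n y v)"
proof -
  have "cyc_dist n x v \<le> Suc (cyc_dist n (Suc x) v)" "cyc_dist n (Suc x) v \<le> Suc (cyc_dist n x v)"
    if "Suc x < n" for x
    using that \<open>v < n\<close> by (auto simp: cyc_dist_if)
  moreover have "cyc_dist n (n - 1) v \<le> Suc (cyc_dist n 0 v)" "cyc_dist n 0 v \<le> Suc (cyc_dist n (n - 1) v)"
    using \<open>v < n\<close> by (auto simp: cyc_dist_if)
  ultimately show ?thesis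
    using assms unfolding cyc_adj_def by (metis diff_Suc_1)
qed

lemma cyc_dist_descent:
  assumes "x < n" "v < n" "x \<noteq> v"
  shows "\<exists>y<n. cyc_adj n x y \<and> cyc_dist n x v = Suc (cyc_dist n y v)"
proof -
  let ?up = "if Suc x = n then 0 else Suc x" and ?down = "if x = 0 then n - 1 else x - 1"
  \<comment> \<open>Here a shortest arc to \<open>v\<close> leaves \<open>x\<close> upwards, in the
    remaining case downwards.\<close>
  have "cyc_dist n x v = Suc (cyc_dist n ?up v)"
    if "x < v \<and> 2 * (v - x) \<le> n \<or> v < x \<and> 2 * (x - v) > n"
    using assms that by (auto simp: cyc_dist_if)
  moreover have "cyc_dist n x v = Suc (cyc_dist n ?down v)"
    if "\<not> (x < v \<and> 2 * (v - x) \<le> n \<or> v < x \<and> 2 * (x - v) > n)"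
    using assms that by (auto simp: cyc_dist_if)
  moreover have "?up < n" "?down < n" "cyc_adj n x ?up" "cyc_adj n x ?down"
    using assms by (auto simp: cyc_adj_def)
  ultimately show ?thesis by blast
qed

text \<open>Only c + d and c - d modulo n lie at distance d from \<open>c\<close>; for vertices
  below \<open>n\<close> these congruences unfold into four linear equations.\<close>

lemma cyc_dist_cases:
  assumes "x < n" "c < n"
  obtains "x = c + cyc_dist n x c" | "c = x + cyc_dist n x c"
    | "x + n = c + cyc_dist n x c" | "x + cyc_dist n x c = c + n"
proof -
  consider "x \<le> c" "2 * (c - x) \<le> n" | "x \<le> c" "\<not> 2 * (c - x) \<le> n"
    | "\<not> x \<le> c" "2 * (x - c) \<le> n" | "\<not> x \<le> c" "\<not> 2 * (x - c) \<le> n"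
    by blast
  then show ?thesis
  proof cases
    case 1
    then show ?thesis by (intro that(2)) (simp add: cyc_dist_if)
  next
    case 2
    then show ?thesis using assms by (intro that(3)) (simp add: cyc_dist_if)
  next
    case 3
    then show ?thesis by (intro that(1)) (simp add: cyc_dist_if)
  next
    case 4
    then show ?thesis using assms by (intro that(4)) (simp add: cyc_dist_if)
  qed
qed

section \<open>Which landmarks separate the vertices of a cycle\<close>

text \<open>Distinct vertices at the same distance from \<open>c\<close> are mirror images in
  \<open>c\<close>, so \<open>y + z\<close> and \<open>2 * c\<close> agree modulo
  \<open>n\<close>.\<close>

lemma cyc_dist_eqD:
  assumes eq: "cyc_dist n y c = cyc_dist n z c" and "y < n" "z < n" "c < n"
  shows "y = z \<or> y + z = 2 * c \<or> y + z = 2 * c + n \<or> y + z + n = 2 * c"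
  by (rule cyc_dist_cases[OF \<open>y < n\<close> \<open>c < n\<close>]; rule cyc_dist_cases[OF \<open>z < n\<close> \<open>c < n\<close>];
      use eq \<open>y < n\<close> \<open>z < n\<close> in linarith)

lemma cyc_dist_le: "2 * cyc_dist n x y \<le> n"
  by (auto simp: cyc_dist_if)

text \<open>Reflection in \<open>c\<close> swaps the two neighbours of \<open>c\<close> and fixes
  \<open>c\<close> and, for even \<open>n\<close>, its antipode.\<close>

lemma cycle_mirror_pair:
  assumes "n \<ge> 3" "c < n"
  shows "\<exists>y<n. \<exists>z<n. y \<noteq> z \<and> cyc_dist n y c = cyc_dist n z c \<and>
    (\<forall>v<n. v = c \<or> 2 * cyc_dist n c v = n \<longrightarrow> cyc_dist n y v = cyc_dist n z v)"
proof -
  let ?up = "if Suc c = n then 0 else Suc c" and ?down = "if c = 0 then n - 1 else c - 1"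
  have "?up < n" "?down < n" "?up \<noteq> ?down" using assms by auto
  moreover have "cyc_dist n ?up c = 1" "cyc_dist n ?down c = 1"
    using assms by (auto simp: cyc_dist_if)
  moreover have "cyc_dist n ?up v = cyc_dist n ?down v" if "v < n" "2 * cyc_dist n c v = n" for v
  proof -
    define m where "m = cyc_dist n c v"
    have n: "n = 2 * m" using that by (simp add: m_def)
    have "v = c + m \<or> c = v + m"
      by (rule cyc_dist_cases[OF \<open>c < n\<close> \<open>v < n\<close>]) (use n assms(2) that(1) m_def in linarith)+
    then show ?thesis
    proof
      assume "v = c + m"
      then show ?thesis using n that(1) assms by (auto simp: cyc_dist_if)
    next
      assume "c = v + m"
      then show ?thesis using n that(1) assms by (auto simp: cyc_dist_if)
    qed
  qed
  ultimately show ?thesis by (intro exI[of _ ?up] exI[of _ ?down] conjI) auto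
qed

text \<open>A step from \<open>c\<close> away from \<open>v\<close> gains one unless it passes the
  middle of the cycle. For even \<open>n\<close> this excludes only the antipode; in an odd cycle a
  vertex at maximal distance has no farther neighbour either.\<close>

lemma cycle_farther_neighbour:
  assumes "even n" "c < n" "v < n" "2 * cyc_dist n c v \<noteq> n" "n \<ge> 3"
  shows "\<exists>y<n. cyc_dist n y c = 1 \<and> cyc_dist n y v = Suc (cyc_dist n c v)"
proof -
  let ?up = "if Suc c = n then 0 else Suc c" and ?down = "if c = 0 then n - 1 else c - 1"
  obtain m where n: "n = 2 * m" using assms(1) by (rule evenE)
  have m: "m \<ge> 2" using \<open>n \<ge> 3\<close> n by simp
  then have "cyc_dist n ?up c = 1" "cyc_dist n ?down c = 1" "?up < n" "?down < n"
    using assms(2) n by (auto simp: cyc_dist_if)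
  moreover have "cyc_dist n ?up v = Suc (cyc_dist n c v) \<or> cyc_dist n ?down v = Suc (cyc_dist n c v)"
  proof (cases "c < v \<and> 2 * (v - c) \<le> n \<or> v < c \<and> 2 * (c - v) > n")
    case True
    have "v - c \<noteq> m" using True assms(2-4) n by (auto simp: cyc_dist_if)
    then have "cyc_dist n ?down v = Suc (cyc_dist n c v)"
      using True assms(2,3) n by (auto simp: cyc_dist_if)
    then show ?thesis ..
  next
    case False
    have "cyc_dist n c v = m" if "c = v + m" using that n by (simp add: cyc_dist_if)
    then have "c \<noteq> v + m" using assms(4) n by auto
    with False n consider "c = v" | "c < v" "v - c > m" | "v < c" "c - v < m" by linarith
    then have "cyc_dist n ?up v = Suc (cyc_dist n c v)"
      using assms(2,3) n m by cases (auto simp: cyc_dist_if)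
    then show ?thesis ..
  qed
  ultimately show ?thesis by blast
qed

text \<open>If distinct vertices were mirror images both in \<open>c\<close> and in
  \<open>v\<close>, then \<open>2 * c\<close> and \<open>2 * v\<close> would agree modulo
  \<open>n\<close>. This is impossible when \<open>c\<close> and \<open>v\<close> are
  \<open>h\<close> apart with 0 < 2h < n. The largest such \<open>h\<close> is taken, which for odd
  \<open>n\<close> is the diameter.\<close>

lemma exists_cycle_landmark:
  assumes "n \<ge> 3" "c < n"
  shows "\<exists>v<n. (\<forall>y<n. \<forall>z<n. cyc_dist n y c = cyc_dist n z c \<and> cyc_dist n y v = cyc_dist n z v \<longrightarrow> y = z) \<and>
    (odd n \<longrightarrow> (\<forall>y<n. cyc_dist n y v \<le> cyc_dist n c v))"
proof -
  define h where "h = (n - 1) div 2"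
  define v where "v = (if c + h < n then c + h else c + h - n)"
  have h: "h \<ge> 1" "2 * h < n" using assms(1) unfolding h_def by linarith+
  have v: "v < n" "v = c + h \<or> c + h = v + n" and dist: "cyc_dist n c v = h"
    using assms(2) h by (auto simp: v_def cyc_dist_if)
  have "y = z" if "y < n" "z < n" "cyc_dist n y c = cyc_dist n z c" "cyc_dist n y v = cyc_dist n z v" for y z
    using cyc_dist_eqD[OF that(3,1,2) assms(2)] cyc_dist_eqD[OF that(4,1,2) v(1)] v(2)
    using h assms(2) that(1,2) v(1) by (elim disjE) linarith+
  moreover have "cyc_dist n y v \<le> cyc_dist n c v" if "odd n" for y
    using cyc_dist_le[of n y v] that unfolding dist by (auto simp: h_def elim!: oddE)
  ultimately show ?thesis using v(1) by (intro exI[of _ v]) auto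
qed

section \<open>Locating sets\<close>

lemma card_le_1I:
  assumes "finite W" "\<And>x y. x \<in> W \<Longrightarrow> y \<in> W \<Longrightarrow> x = y"
  shows "card W \<le> 1"
  using assms by (auto simp: card_le_Suc0_iff_eq)

text \<open>A vertex outside \<open>S\<close> with exactly one neighbour in \<open>S\<close> is determined by that neighbour, so there
  are at most \<open>card S\<close> of them; the other dominated vertices each use two of the at most
  \<open>2 * card S\<close> pairs in \<open>R\<close>.\<close>

lemma locating_card_bound:
  assumes fin: "finite V" and SV: "S \<subseteq> V"
    and deg: "\<And>s. s \<in> S \<Longrightarrow> card {x \<in> V. R x s} \<le> 2"
    and loc: "\<And>x y. x \<in> V - S \<Longrightarrow> y \<in> V - S \<Longrightarrow> x \<noteq> y \<Longrightarrow> \<exists>s\<in>S. R x s \<noteq> R y s"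
  shows "2 * card V \<le> 5 * card S + 2 * card {x \<in> V - S. \<forall>s\<in>S. \<not> R x s}"
proof -
  define U where "U = {x \<in> V - S. \<forall>s\<in>S. \<not> R x s}"
  define W where "W = V - S - U"
  define N where "N x = {s \<in> S. R x s}" for x
  define A where "A = {x \<in> W. card (N x) = 1}"
  have finS: "finite S" and finW: "finite W" and finU: "finite U"
    using fin SV finite_subset by (auto simp: W_def U_def)
  have finN: "finite (N x)" for x using finS by (simp add: N_def)
  have "inj_on N A"
  proof (rule inj_onI)
    fix x y assume "x \<in> A" "y \<in> A" "N x = N y"
    then have "\<forall>s\<in>S. R x s = R y s" by (auto simp: N_def set_eq_iff)
    with loc[of x y] \<open>x \<in> A\<close> \<open>y \<in> A\<close> show "x = y" by (auto simp: A_def W_def)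
  qed
  moreover have "N ` A \<subseteq> (\<lambda>s. {s}) ` S"
    by (auto simp: A_def N_def card_1_singleton_iff)
  ultimately have A: "card A \<le> card S"
    using card_inj_on_le[of N A "(\<lambda>s. {s}) ` S"] finS card_image_le[OF finS, of "\<lambda>s. {s}"] by fastforce
  have "(\<Sum>x\<in>W. card (N x)) = (\<Sum>x\<in>W. \<Sum>s\<in>S. of_bool (R x s))"
    using finS by (simp add: N_def Int_def Collect_conj_eq[symmetric])
  also have "\<dots> = (\<Sum>s\<in>S. \<Sum>x\<in>W. of_bool (R x s))" by (rule sum.swap)
  also have "\<dots> \<le> (\<Sum>s\<in>S. 2)"
  proof (rule sum_mono)
    fix s assume "s \<in> S"
    have "(\<Sum>x\<in>W. of_bool (R x s)) = card {x \<in> W. R x s}"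
      using finW by (simp add: Int_def)
    also have "\<dots> \<le> card {x \<in> V. R x s}"
      using fin by (intro card_mono) (auto simp: W_def)
    finally show "(\<Sum>x\<in>W. of_bool (R x s)) \<le> (2 :: nat)" using deg[OF \<open>s \<in> S\<close>] by simp
  qed
  finally have sum: "(\<Sum>x\<in>W. card (N x)) \<le> 2 * card S" by simp
  have "2 * card W = (\<Sum>x\<in>W. 2)" by simp
  \<comment> \<open>The extra term lifts vertices with a single neighbour in \<open>S\<close> to 2;
    the others in \<open>W\<close> have at least two.\<close>
  also have "\<dots> \<le> (\<Sum>x\<in>W. of_bool (card (N x) = 1) + card (N x))"
  proof (rule sum_mono)
    fix x assume "x \<in> W"
    then have "N x \<noteq> {}" by (auto simp: W_def U_def N_def)
    then have "card (N x) \<noteq> 0" using finN by simp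
    then show "2 \<le> of_bool (card (N x) = 1) + card (N x)" by simp
  qed
  also have "\<dots> = card A + (\<Sum>x\<in>W. card (N x))"
    using finW by (simp add: sum.distrib A_def Int_def)
  finally have W: "2 * card W \<le> 3 * card S" using A sum by simp
  have "card V = card S + card (V - S)"
    using card_Diff_subset[OF finS SV] card_mono[OF fin SV] by simp
  also have "card (V - S) = card W + card U"
  proof -
    have "V - S = W \<union> U" "W \<inter> U = {}" by (auto simp: W_def U_def)
    then show ?thesis using card_Un_disjoint[OF finW finU] by simp
  qed
  finally show ?thesis using W by (simp add: U_def)
qed

lemma card_cyc_adj_le_2:
  assumes "s < n"
  shows "card {x \<in> {..<n}. cyc_adj n x s} \<le> 2"
proof -
  let ?up = "if Suc s = n then 0 else Suc s" and ?down = "if s = 0 then n - 1 else s - 1"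
  have "{x \<in> {..<n}. cyc_adj n x s} \<subseteq> {?up, ?down}"
    using assms by (auto simp: cyc_adj_def)
  then have "card {x \<in> {..<n}. cyc_adj n x s} \<le> card {?up, ?down}" by (intro card_mono) auto
  also have "\<dots> \<le> 2" by (simp add: card_insert_le_m1)
  finally show ?thesis .
qed

text \<open>Vertices of \<open>S\<close> are exempt, since each is the only one at distance 0 from
  itself. One vertex outside \<open>S\<close> may still have no neighbour in
  \<open>S\<close>.\<close>

definition cyc_locating :: "nat \<Rightarrow> nat set \<Rightarrow> bool" where
  "cyc_locating n S \<longleftrightarrow> S \<subseteq> {..<n} \<and>
    (\<forall>x\<in>{..<n} - S. \<forall>y\<in>{..<n} - S. x \<noteq> y \<longrightarrow> (\<exists>s\<in>S. cyc_adj n x s \<noteq> cyc_adj n y s))"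

definition cyc_dominating :: "nat \<Rightarrow> nat set \<Rightarrow> bool" where
  "cyc_dominating n S \<longleftrightarrow> (\<forall>x\<in>{..<n} - S. \<exists>s\<in>S. cyc_adj n x s)"

lemma cyc_locating_card:
  assumes "cyc_locating n S"
  shows "2 * n \<le> 5 * card S + 2"
    and "cyc_dominating n S \<Longrightarrow> 2 * n \<le> 5 * card S"
proof -
  let ?U = "{x \<in> {..<n} - S. \<forall>s\<in>S. \<not> cyc_adj n x s}"
  have *: "2 * n \<le> 5 * card S + 2 * card ?U"
    using locating_card_bound[of "{..<n}" S "cyc_adj n"] assms card_cyc_adj_le_2
    by (auto simp: cyc_locating_def subset_iff)
  \<comment> \<open>Two undominated vertices would share the empty neighbourhood in
    \<open>S\<close>.\<close>
  have "card ?U \<le> 1"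
    using assms by (intro card_le_1I) (simp, simp add: cyc_locating_def, blast)
  with * show "2 * n \<le> 5 * card S + 2" by simp
  show "2 * n \<le> 5 * card S" if "cyc_dominating n S"
  proof -
    have "?U = {}" using that by (auto simp: cyc_dominating_def)
    with * show ?thesis by (simp del: Collect_empty_eq)
  qed
qed

section \<open>Optimal locating sets from blocks of five vertices\<close>

text \<open>In each block the unchosen offsets 0, 2, 4 see {1}, {1, 3}, {3}. Both ends are unchosen,
  so blocks do not interfere, and two chosen out of five give equality in the counting
  bound.\<close>

definition blocks :: "nat \<Rightarrow> nat set" where
  "blocks k = (\<lambda>i. 5 * i + 1) ` {..<k} \<union> (\<lambda>i. 5 * i + 3) ` {..<k}"

lemma card_blocks_Un_le: "card (blocks k \<union> E) \<le> 2 * k + card E"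
proof -
  have "card (blocks k) \<le> k + k"
    unfolding blocks_def
    by (rule order_trans[OF card_Un_le]) (intro add_mono; metis card_image_le card_lessThan finite_lessThan)
  then show ?thesis using card_Un_le[of "blocks k" E] by simp
qed

lemma less_5_cases: "(r::nat) < 5 \<Longrightarrow> r = 0 \<or> r = 1 \<or> r = 2 \<or> r = 3 \<or> r = 4"
  by linarith

lemma below_blocks_cases:
  assumes "x < 5 * k" "x \<notin> blocks k"
  obtains a where "a < k" "x = 5 * a \<or> x = 5 * a + 2 \<or> x = 5 * a + 4"
proof -
  define a where "a = x div 5"
  have "x = 5 * a + x mod 5" "x mod 5 < 5" by (simp_all add: a_def)
  moreover have "a < k" using assms(1) by (simp add: a_def less_mult_imp_div_less mult.commute)
  moreover from \<open>a < k\<close> have "5 * a + 1 \<in> blocks k" "5 * a + 3 \<in> blocks k" by (auto simp: blocks_def)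
  ultimately have "x = 5 * a \<or> x = 5 * a + 2 \<or> x = 5 * a + 4"
    using assms(2) less_5_cases[of "x mod 5"] by (metis add.right_neutral)
  with \<open>a < k\<close> show ?thesis by (rule that)
qed

text \<open>The two landmarks of a block have all their neighbours inside it, so they separate
  \<open>x\<close> from every other \<open>y\<close>, even from one outside the blocks.\<close>

lemma blocks_locate:
  assumes "5 * k \<le> n" "blocks k \<subseteq> S" "x < 5 * k" "x \<notin> blocks k" "x \<noteq> y"
  shows "\<exists>s\<in>S. cyc_adj n x s \<noteq> cyc_adj n y s"
proof -
  obtain a where a: "a < k" "x = 5 * a \<or> x = 5 * a + 2 \<or> x = 5 * a + 4"
    using below_blocks_cases assms(3,4) by blast
  then have "5 * a + 1 \<in> S" "5 * a + 3 \<in> S" using assms(2) by (auto simp: blocks_def)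
  moreover have "cyc_adj n z (5 * a + 1) \<longleftrightarrow> z = 5 * a \<or> z = 5 * a + 2"
    and "cyc_adj n z (5 * a + 3) \<longleftrightarrow> z = 5 * a + 2 \<or> z = 5 * a + 4" for z
    using a(1) assms(1) by (auto simp: cyc_adj_def)
  moreover have "(x = 5 * a \<or> x = 5 * a + 2) \<noteq> (y = 5 * a \<or> y = 5 * a + 2) \<or>
      (x = 5 * a + 2 \<or> x = 5 * a + 4) \<noteq> (y = 5 * a + 2 \<or> y = 5 * a + 4)"
    using a(2) assms(5) by auto
  ultimately show ?thesis by blast
qed

lemma blocks_dominate:
  assumes "blocks k \<subseteq> S" "x < 5 * k" "x \<notin> blocks k"
  shows "\<exists>s\<in>S. cyc_adj n x s"
proof -
  obtain a where a: "a < k" "x = 5 * a \<or> x = 5 * a + 2 \<or> x = 5 * a + 4"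
    using below_blocks_cases assms(2,3) by blast
  then have "5 * a + 1 \<in> S" "5 * a + 3 \<in> S" using assms(1) by (auto simp: blocks_def)
  with a(2) show ?thesis
    by (intro bexI[of _ "if x = 5 * a + 4 then 5 * a + 3 else 5 * a + 1"]) (auto simp: cyc_adj_def)
qed

lemma blocks_less: "i \<in> blocks k \<Longrightarrow> i < 5 * k"
  by (auto simp: blocks_def)

lemma cyc_locating_blocks:
  assumes "5 * k \<le> n" "E \<subseteq> {5 * k..<n}"
    and "\<And>x y. x \<in> {5 * k..<n} - E \<Longrightarrow> y \<in> {5 * k..<n} - E \<Longrightarrow> x < y \<Longrightarrow>
      \<exists>s\<in>E. cyc_adj n x s \<noteq> cyc_adj n y s"
  shows "cyc_locating n (blocks k \<union> E)"
  unfolding cyc_locating_def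
proof (intro conjI ballI impI)
  show "blocks k \<union> E \<subseteq> {..<n}" using assms(1,2) by (auto dest!: blocks_less)
next
  fix x y assume xy: "x \<in> {..<n} - (blocks k \<union> E)" "y \<in> {..<n} - (blocks k \<union> E)" "x \<noteq> y"
  consider "x < 5 * k" | "y < 5 * k" | "x \<ge> 5 * k" "y \<ge> 5 * k" by linarith
  then show "\<exists>s\<in>blocks k \<union> E. cyc_adj n x s \<noteq> cyc_adj n y s"
  proof cases
    case 1
    then show ?thesis using blocks_locate[of k n "blocks k \<union> E" x y] assms(1) xy by auto
  next
    case 2
    then show ?thesis using blocks_locate[of k n "blocks k \<union> E" y x] assms(1) xy by auto
  next
    case 3
    then have "\<exists>s\<in>E. cyc_adj n x s \<noteq> cyc_adj n y s"
      using assms(3)[of x y] assms(3)[of y x] xy by (cases "x < y") auto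
    then show ?thesis by auto
  qed
qed

lemma cyc_dominating_blocks:
  assumes "\<And>x. x \<in> {5 * k..<n} - E \<Longrightarrow> \<exists>s\<in>E. cyc_adj n x s"
  shows "cyc_dominating n (blocks k \<union> E)"
  unfolding cyc_dominating_def
proof
  fix x assume x: "x \<in> {..<n} - (blocks k \<union> E)"
  show "\<exists>s\<in>blocks k \<union> E. cyc_adj n x s"
  proof (cases "x < 5 * k")
    case True
    then show ?thesis using blocks_dominate[of k "blocks k \<union> E" x n] x by auto
  next
    case False
    then show ?thesis using assms[of x] x by auto
  qed
qed

text \<open>The bound leaves only the ceiling of (2n - 2) / 5 for the cardinality, the least value
  that \<open>cyc_locating_card\<close> permits without domination.\<close>

lemma exists_cyc_locating:
  assumes "n \<ge> 5"
  shows "\<exists>S. cyc_locating n S \<and> S \<noteq> {} \<and> 5 * card S \<le> 2 * n + 2"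
proof -
  define k where "k = n div 5"
  define r where "r = n mod 5"
  have n: "n = 5 * k + r" and r: "r < 5" and k: "k \<ge> 1" using assms by (auto simp: k_def r_def)
  \<comment> \<open>For \<open>r = 1\<close> and \<open>r = 3\<close> the vertex
    \<open>5 * k\<close> stays undominated, which saves a landmark.\<close>
  define E where "E = (if r = 2 then {5 * k + 1} else if r = 3 then {5 * k + 2}
    else if r = 4 then {5 * k + 1, 5 * k + 3} else {})"
  have "cyc_locating n (blocks k \<union> E)"
    using less_5_cases[OF r] k n
    by (intro cyc_locating_blocks; elim disjE) (auto simp: E_def cyc_adj_def)
  moreover have "5 * card (blocks k \<union> E) \<le> 2 * n + 2"
    using card_blocks_Un_le[of k E] less_5_cases[OF r] n by (auto simp: E_def)
  moreover have "blocks k \<noteq> {}" using k by (auto simp: blocks_def lessThan_empty_iff)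
  ultimately show ?thesis by blast
qed

text \<open>With domination the least cardinality is the ceiling of 2n / 5, and the bound leaves
  only this value.\<close>

lemma exists_cyc_locating_dominating:
  assumes "n \<ge> 4"
  shows "\<exists>S. cyc_locating n S \<and> cyc_dominating n S \<and> S \<noteq> {} \<and> 5 * card S \<le> 2 * n + 4"
proof (cases "n = 4")
  \<comment> \<open>There is no complete block, and the remainder pattern {1, 3} would give 0 and 2
    the same neighbourhood around the cycle.\<close>
  case True
  have "{..<4::nat} = {0, 1, 2, 3}" by auto
  then show ?thesis using True
    by (intro exI[of _ "{0, 1}"]) (auto simp: cyc_locating_def cyc_dominating_def cyc_adj_def)
next
  case False
  define k where "k = n div 5"
  define r where "r = n mod 5"
  have n: "n = 5 * k + r" and r: "r < 5" and k: "k \<ge> 1" using assms False by (auto simp: k_def r_def)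
  define E where "E = (if r = 1 then {5 * k} else if r = 2 then {5 * k + 1}
    else if r = 3 then {5 * k + 1, 5 * k + 2} else if r = 4 then {5 * k + 1, 5 * k + 3} else {})"
  have "cyc_locating n (blocks k \<union> E)"
    using less_5_cases[OF r] k n
    by (intro cyc_locating_blocks; elim disjE) (auto simp: E_def cyc_adj_def)
  moreover have "cyc_dominating n (blocks k \<union> E)"
    using less_5_cases[OF r] k n
    by (intro cyc_dominating_blocks; elim disjE) (auto simp: E_def cyc_adj_def)
  moreover have "5 * card (blocks k \<union> E) \<le> 2 * n + 4"
    using card_blocks_Un_le[of k E] less_5_cases[OF r] n by (auto simp: E_def)
  moreover have "blocks k \<noteq> {}" using k by (auto simp: blocks_def lessThan_empty_iff)
  ultimately show ?thesis by blast
qed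

section \<open>The functigraph of a constant function\<close>

definition hub_graph :: "nat \<Rightarrow> nat \<Rightarrow> (nat + nat) graph" where
  "hub_graph n c = functigraph (cycle_graph n) (\<lambda>_. c)"

lemma verts_hub_graph: "verts (hub_graph n c) = Inl ` {..<n} \<union> Inr ` {..<n}"
  by (simp add: hub_graph_def functigraph_def cycle_graph_def atLeast0LessThan)

lemma image_doubleton_mem:
  assumes "inj g"
  shows "{g x, g y} \<in> (\<lambda>e. g ` e) ` E \<longleftrightarrow> {x, y} \<in> E"
proof -
  have "{g x, g y} = g ` {x, y}" by simp
  then show ?thesis using inj_image_eq_iff[OF assms] by (metis (no_types, lifting) imageE imageI)
qed

lemma hub_graph_edges_iff:
  assumes "n \<ge> 3"
  shows "{Inl x, Inl y} \<in> edges (hub_graph n c) \<longleftrightarrow> x < n \<and> y < n \<and> cyc_adj n x y"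
    and "{Inr x, Inr y} \<in> edges (hub_graph n c) \<longleftrightarrow> x < n \<and> y < n \<and> cyc_adj n x y"
    and "{Inl x, Inr y} \<in> edges (hub_graph n c) \<longleftrightarrow> x < n \<and> y = c"
    and "{Inr y, Inl x} \<in> edges (hub_graph n c) \<longleftrightarrow> x < n \<and> y = c"
proof -
  let ?E = "edges (cycle_graph n)"
  have E: "edges (hub_graph n c) = (\<lambda>e. Inl ` e) ` ?E \<union> (\<lambda>e. Inr ` e) ` ?E \<union> {{Inl u, Inr c} |u. u < n}"
    by (simp add: hub_graph_def functigraph_def) (simp add: cycle_graph_def)
  have no: "{Inl a, z} \<notin> (\<lambda>e. Inr ` e) ` ?E" "{Inr a, z} \<notin> (\<lambda>e. Inl ` e) ` ?E"
    for a and z :: "nat + nat" by auto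
  have no': "{z, Inl a} \<notin> (\<lambda>e. Inr ` e) ` ?E" "{z, Inr a} \<notin> (\<lambda>e. Inl ` e) ` ?E"
    for a and z :: "nat + nat" using no by (simp_all add: insert_commute)
  note [simp] = no no' image_doubleton_mem[OF inj_Inl] image_doubleton_mem[OF inj_Inr] cycle_edges_iff[OF assms]
  show "{Inl x, Inl y} \<in> edges (hub_graph n c) \<longleftrightarrow> x < n \<and> y < n \<and> cyc_adj n x y"
    unfolding E by (simp add: doubleton_eq_iff)
  show "{Inr x, Inr y} \<in> edges (hub_graph n c) \<longleftrightarrow> x < n \<and> y < n \<and> cyc_adj n x y"
    unfolding E by (simp add: doubleton_eq_iff)
  show 3: "{Inl x, Inr y} \<in> edges (hub_graph n c) \<longleftrightarrow> x < n \<and> y = c"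
    unfolding E by (simp add: doubleton_eq_iff) blast
  show "{Inr y, Inl x} \<in> edges (hub_graph n c) \<longleftrightarrow> x < n \<and> y = c"
    using 3 by (simp add: insert_commute)
qed

section \<open>Distances in the functigraph\<close>

definition rim_dist :: "nat \<Rightarrow> nat \<Rightarrow> nat \<Rightarrow> nat" where
  "rim_dist n x a = (if x = a then 0 else if cyc_adj n x a then 1 else 2)"

lemma rim_dist_le_2: "rim_dist n x a \<le> 2"
  by (simp add: rim_dist_def)

lemma rim_dist_step: "cyc_adj n x y \<Longrightarrow> rim_dist n x a \<le> Suc (rim_dist n y a)"
  by (auto simp: rim_dist_def)

text \<open>Two rim vertices are joined through the hub \<open>c\<close> by a path of length 2. A
  vertex of the second copy must pass through \<open>c\<close>, which is adjacent to the whole rim,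
  so its distance does not depend on \<open>a\<close>.\<close>

lemma gdist_to_rim:
  assumes "n \<ge> 3" "c < n" "a < n" "x < n"
  shows "gdist (hub_graph n c) (Inl x) (Inl a) = enat (rim_dist n x a)"
    and "gdist (hub_graph n c) (Inr x) (Inl a) = enat (Suc (cyc_dist n x c))"
proof -
  let ?D = "case_sum (\<lambda>x. rim_dist n x a) (\<lambda>y. Suc (cyc_dist n y c))"
  have "gdist (hub_graph n c) u (Inl a) = enat (?D u)" if "u \<in> verts (hub_graph n c)" for u
  proof (rule gdist_eqI)
    fix u v assume "{u, v} \<in> edges (hub_graph n c)"
    then show "?D u \<le> Suc (?D v)"
      using assms
      by (cases u; cases v)
        (auto simp: hub_graph_edges_iff rim_dist_step cyc_dist_step intro: le_trans[OF rim_dist_le_2])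
  next
    fix u assume u: "u \<in> verts (hub_graph n c)" "u \<noteq> Inl a"
    show "\<exists>v\<in>verts (hub_graph n c). {u, v} \<in> edges (hub_graph n c) \<and> ?D u = Suc (?D v)"
    proof (cases u)
      case (Inl x)
      show ?thesis
      proof (cases "cyc_adj n x a")
        case True
        then show ?thesis using Inl u assms
          by (intro bexI[of _ "Inl a"]) (auto simp: hub_graph_edges_iff verts_hub_graph rim_dist_def)
      next
        case False
        then show ?thesis using Inl u assms
          by (intro bexI[of _ "Inr c"]) (auto simp: hub_graph_edges_iff verts_hub_graph rim_dist_def)
      qed
    next
      case (Inr y)
      show ?thesis
      proof (cases "y = c")
        case True
        then show ?thesis using Inr u assms
          by (intro bexI[of _ "Inl a"]) (auto simp: hub_graph_edges_iff verts_hub_graph rim_dist_def)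
      next
        case False
        have "y < n" using u Inr by (auto simp: verts_hub_graph)
        with cyc_dist_descent[OF _ assms(2) False] obtain z
          where "z < n" "cyc_adj n y z" "cyc_dist n y c = Suc (cyc_dist n z c)" by auto
        then show ?thesis using Inr \<open>y < n\<close> assms
          by (intro bexI[of _ "Inr z"]) (auto simp: hub_graph_edges_iff verts_hub_graph)
      qed
    qed
  qed (use that in \<open>auto simp: rim_dist_def\<close>)
  from this[of "Inl x"] this[of "Inr x"] assms
  show "gdist (hub_graph n c) (Inl x) (Inl a) = enat (rim_dist n x a)"
    "gdist (hub_graph n c) (Inr x) (Inl a) = enat (Suc (cyc_dist n x c))"
    by (auto simp: verts_hub_graph)
qed

lemma gdist_to_cycle:
  assumes "n \<ge> 3" "c < n" "v < n" "x < n"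
  shows "gdist (hub_graph n c) (Inl x) (Inr v) = enat (Suc (cyc_dist n c v))"
    and "gdist (hub_graph n c) (Inr x) (Inr v) = enat (cyc_dist n x v)"
proof -
  let ?D = "case_sum (\<lambda>x. Suc (cyc_dist n c v)) (\<lambda>y. cyc_dist n y v)"
  have "gdist (hub_graph n c) u (Inr v) = enat (?D u)" if "u \<in> verts (hub_graph n c)" for u
  proof (rule gdist_eqI)
    fix u w assume "{u, w} \<in> edges (hub_graph n c)"
    then show "?D u \<le> Suc (?D w)"
      using assms by (cases u; cases w) (auto simp: hub_graph_edges_iff cyc_dist_step)
  next
    fix u assume u: "u \<in> verts (hub_graph n c)" "u \<noteq> Inr v"
    show "\<exists>w\<in>verts (hub_graph n c). {u, w} \<in> edges (hub_graph n c) \<and> ?D u = Suc (?D w)"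
    proof (cases u)
      case (Inl x)
      then show ?thesis using u assms
        by (intro bexI[of _ "Inr c"]) (auto simp: hub_graph_edges_iff verts_hub_graph)
    next
      case (Inr y)
      then have "y < n" "y \<noteq> v" using u by (auto simp: verts_hub_graph)
      with cyc_dist_descent[OF _ assms(3)] obtain z
        where "z < n" "cyc_adj n y z" "cyc_dist n y v = Suc (cyc_dist n z v)" by blast
      then show ?thesis using Inr \<open>y < n\<close> assms
        by (intro bexI[of _ "Inr z"]) (auto simp: hub_graph_edges_iff verts_hub_graph)
    qed
  qed (use that in auto)
  from this[of "Inl x"] this[of "Inr x"] assms
  show "gdist (hub_graph n c) (Inl x) (Inr v) = enat (Suc (cyc_dist n c v))"
    "gdist (hub_graph n c) (Inr x) (Inr v) = enat (cyc_dist n x v)"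
    by (auto simp: verts_hub_graph)
qed

section \<open>Resolving sets versus locating sets of the rim\<close>

text \<open>\<open>S\<close> is the rim part of \<open>T\<close>, and \<open>a\<close> counts its
  landmarks in the second copy. Landmarks of the second copy never separate rim vertices, so
  \<open>S\<close> alone must do so.\<close>

lemma resolving_hub_graph_lower:
  assumes n: "n \<ge> 3" "c < n" and T: "resolving_set (hub_graph n c) T" "finite T"
  obtains S and a :: nat where "cyc_locating n S" "a \<ge> 1" "card T = card S + a"
    "even n \<Longrightarrow> a = 1 \<Longrightarrow> cyc_dominating n S"
proof -
  define S where "S = Inl -` T"
  define A where "A = Inr -` T"
  have T_eq: "T = S <+> A"
    proof (rule set_eqI)
    fix t show "t \<in> T \<longleftrightarrow> t \<in> S <+> A" by (cases t) (auto simp: S_def A_def)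
  qed
  have fin: "finite S" "finite A"
    using T(2) by (simp_all add: S_def A_def finite_vimageI)
  have card_T: "card T = card S + card A" unfolding T_eq by (rule card_Plus[OF fin])
  have "T \<subseteq> verts (hub_graph n c)" using T(1) by (simp add: resolving_set_def)
  then have sub: "s \<in> S \<Longrightarrow> s < n" "v \<in> A \<Longrightarrow> v < n" for s v
    by (auto simp: S_def A_def verts_hub_graph)
  have resolved: "(\<exists>s\<in>S. gdist (hub_graph n c) p (Inl s) \<noteq> gdist (hub_graph n c) q (Inl s)) \<or>
      (\<exists>v\<in>A. gdist (hub_graph n c) p (Inr v) \<noteq> gdist (hub_graph n c) q (Inr v))"
    if pq: "p \<in> verts (hub_graph n c)" "q \<in> verts (hub_graph n c)" "p \<noteq> q" for p q
  proof -
    obtain t where "t \<in> T" "gdist (hub_graph n c) p t \<noteq> gdist (hub_graph n c) q t"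
      using resolving_setD[OF T(1) pq] by (rule bexE)
    then show ?thesis unfolding T_eq by (elim PlusE) auto
  qed
  note gd = gdist_to_rim[OF n] gdist_to_cycle[OF n]
  have locating: "cyc_locating n S"
    unfolding cyc_locating_def
  proof (intro conjI ballI impI)
    fix x y assume xy: "x \<in> {..<n} - S" "y \<in> {..<n} - S" "x \<noteq> y"
    then have "\<exists>s\<in>S. rim_dist n x s \<noteq> rim_dist n y s"
      using resolved[of "Inl x" "Inl y"] sub by (auto simp: verts_hub_graph gd)
    \<comment> \<open>Outside \<open>S\<close> the rim distances are 1 or 2, according to
      adjacency.\<close>
    with xy show "\<exists>s\<in>S. cyc_adj n x s \<noteq> cyc_adj n y s"
      by (auto simp: rim_dist_def split: if_splits)
  qed (use sub in auto)
  \<comment> \<open>Otherwise the two neighbours of \<open>c\<close> in the second copy stay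
    unresolved. Beyond \<open>a \<ge> 1\<close>, this shows that a single landmark is not antipodal
    to \<open>c\<close>.\<close>
  have landmark: "\<exists>v\<in>A. v \<noteq> c \<and> 2 * cyc_dist n c v \<noteq> n"
  proof (rule ccontr)
    assume none: "\<not> ?thesis"
    obtain y z where yz: "y < n" "z < n" "y \<noteq> z" "cyc_dist n y c = cyc_dist n z c"
      and mirror: "\<forall>v<n. v = c \<or> 2 * cyc_dist n c v = n \<longrightarrow> cyc_dist n y v = cyc_dist n z v"
      using cycle_mirror_pair[OF n] by blast
    show False
      using resolved[of "Inr y" "Inr z"] yz mirror none sub by (auto simp: verts_hub_graph gd)
  qed
  then have "A \<noteq> {}" by auto
  with fin(2) have "card A \<ge> 1" by (simp add: Suc_le_eq card_gt_0_iff)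
  have "cyc_dominating n S" if "even n" "card A = 1"
  proof -
    from landmark obtain v where v: "v \<in> A" "2 * cyc_dist n c v \<noteq> n" by blast
    with \<open>card A = 1\<close> have A: "A = {v}" by (metis card_1_singletonE singletonD)
    have "v < n" using v(1) sub by simp
    from cycle_farther_neighbour[OF \<open>even n\<close> n(2) this v(2) n(1)] obtain y
      where y: "y < n" "cyc_dist n y c = 1" "cyc_dist n y v = Suc (cyc_dist n c v)" by blast
    show ?thesis
      unfolding cyc_dominating_def
    proof
      fix x assume x: "x \<in> {..<n} - S"
      \<comment> \<open>The vertex \<open>y\<close> is at distance 2 from every rim landmark and as
        far from \<open>v\<close> as the rim is.\<close>
      have "\<exists>s\<in>S. rim_dist n x s \<noteq> 2"
        using resolved[of "Inl x" "Inr y"] x y sub \<open>v < n\<close> by (auto simp: verts_hub_graph gd A numeral_2_eq_2)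
      with x show "\<exists>s\<in>S. cyc_adj n x s" by (auto simp: rim_dist_def split: if_splits)
    qed
  qed
  with locating \<open>card A \<ge> 1\<close> card_T show ?thesis by (rule that)
qed

text \<open>One well placed landmark \<open>v\<close> completes \<open>S\<close>: rim pairs are
  resolved by \<open>S\<close>, pairs in the second copy by \<open>v\<close> and any rim landmark.
  Mixed pairs rely on domination for even \<open>n\<close> and on the maximal distance between
  \<open>c\<close> and \<open>v\<close> for odd \<open>n\<close>.\<close>

lemma resolving_hub_graph_exists:
  assumes n: "n \<ge> 3" "c < n" and S: "cyc_locating n S" "S \<noteq> {}"
    and dom: "even n \<Longrightarrow> cyc_dominating n S"
  obtains T where "resolving_set (hub_graph n c) T" "finite T" "card T = card S + 1"
proof -
  obtain v where v: "v < n"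
    and inj: "\<And>y z. y < n \<Longrightarrow> z < n \<Longrightarrow> cyc_dist n y c = cyc_dist n z c \<Longrightarrow>
      cyc_dist n y v = cyc_dist n z v \<Longrightarrow> y = z"
    and far: "\<And>y. odd n \<Longrightarrow> y < n \<Longrightarrow> cyc_dist n y v \<le> cyc_dist n c v"
    using exists_cycle_landmark[OF n] by blast
  define T where "T = S <+> {v}"
  have sub: "s < n" if "s \<in> S" for s using S(1) that by (auto simp: cyc_locating_def)
  then have finS: "finite S" by (meson finite_lessThan finite_subset lessThan_iff subsetI)
  note gd = gdist_to_rim[OF n] gdist_to_cycle[OF n]
  have same_rim: "x = y" if "x < n" "y < n" "\<And>s. s \<in> S \<Longrightarrow> rim_dist n x s = rim_dist n y s" for x y
  proof (rule ccontr)
    assume "x \<noteq> y"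
    have "x \<notin> S" "y \<notin> S" using that(3)[of x] that(3)[of y] \<open>x \<noteq> y\<close> by (auto simp: rim_dist_def split: if_splits)
    with S(1) that(1,2) \<open>x \<noteq> y\<close> obtain s where "s \<in> S" "cyc_adj n x s \<noteq> cyc_adj n y s"
      unfolding cyc_locating_def by blast
    with that(3)[of s] \<open>x \<notin> S\<close> \<open>y \<notin> S\<close> show False by (auto simp: rim_dist_def split: if_splits)
  qed
  have rim_cycle: False
    if "x < n" "y < n" and rim: "\<And>s. s \<in> S \<Longrightarrow> rim_dist n x s = Suc (cyc_dist n y c)"
      and v_eq: "Suc (cyc_dist n c v) = cyc_dist n y v" for x y
  proof -
    \<comment> \<open>As \<open>y\<close> differs from the hub, it is at distance at least 2 from
      every rim landmark; \<open>x\<close> has the same distances, so it is undominated.\<close>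
    have "y \<noteq> c" using v_eq by auto
    then have pos: "cyc_dist n y c > 0" using cyc_dist_eq_0_iff[of y n c] that(2) n(2) by simp
    then have no: "x \<noteq> s \<and> \<not> cyc_adj n x s" if "s \<in> S" for s
      using rim[OF that] by (auto simp: rim_dist_def split: if_splits)
    show False
    proof (cases "even n")
      case True
      with dom no that(1) show False unfolding cyc_dominating_def by blast
    next
      case False
      with far[of y] that(2) v_eq show False by simp
    qed
  qed
  have eqI: "p = q" if "p \<in> verts (hub_graph n c)" "q \<in> verts (hub_graph n c)"
    and rim: "\<And>s. s \<in> S \<Longrightarrow> gdist (hub_graph n c) p (Inl s) = gdist (hub_graph n c) q (Inl s)"
    and lm: "gdist (hub_graph n c) p (Inr v) = gdist (hub_graph n c) q (Inr v)" for p q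
  proof (cases p)
    case p: (Inl x)
    with that(1) have x: "x < n" by (auto simp: verts_hub_graph)
    show ?thesis
    proof (cases q)
      case q: (Inl y)
      with that(2) have "y < n" by (auto simp: verts_hub_graph)
      with x same_rim[of x y] rim sub show ?thesis unfolding p q by (simp add: gd)
    next
      case q: (Inr y)
      with that(2) have "y < n" by (auto simp: verts_hub_graph)
      with x rim_cycle[of x y] rim lm sub v show ?thesis unfolding p q by (simp add: gd)
    qed
  next
    case p: (Inr x)
    with that(1) have x: "x < n" by (auto simp: verts_hub_graph)
    show ?thesis
    proof (cases q)
      case q: (Inl y)
      with that(2) have "y < n" by (auto simp: verts_hub_graph)
      with x rim_cycle[of y x] rim lm sub v show ?thesis unfolding p q by (simp add: gd)
    next
      case q: (Inr y)
      with that(2) have y: "y < n" by (auto simp: verts_hub_graph)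
      \<comment> \<open>Any single rim landmark reveals the distance to \<open>c\<close>.\<close>
      obtain s where "s \<in> S" using S(2) by blast
      with rim[OF this] sub x y have "cyc_dist n x c = cyc_dist n y c" unfolding p q by (simp add: gd)
      with inj[of x y] lm x y v show ?thesis unfolding p q by (simp add: gd)
    qed
  qed
  have "resolving_set (hub_graph n c) T"
    unfolding resolving_set_def
  proof (intro conjI ballI impI)
    show "T \<subseteq> verts (hub_graph n c)" using sub v by (auto simp: T_def verts_hub_graph)
  next
    fix p q assume pq: "p \<in> verts (hub_graph n c)" "q \<in> verts (hub_graph n c)" "p \<noteq> q"
    show "\<exists>t\<in>T. gdist (hub_graph n c) p t \<noteq> gdist (hub_graph n c) q t"
    proof (rule ccontr)
      assume "\<not> ?thesis"
      then have eq: "\<And>t. t \<in> T \<Longrightarrow> gdist (hub_graph n c) p t = gdist (hub_graph n c) q t"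
        by blast
      have "p = q" by (rule eqI[OF pq(1,2)]) (auto intro!: eq simp: T_def)
      with pq(3) show False by blast
    qed
  qed
  moreover have "finite T" "card T = card S + 1"
    using finS by (simp_all add: T_def card_Plus)
  ultimately show ?thesis by (rule that)
qed

section \<open>Evaluation of the minimum\<close>

text \<open>Reduces the metric dimension to minimising \<open>card S + a\<close> over locating sets
  of the rim; the minimum is attained with \<open>a = 1\<close>.\<close>

lemma metric_dim_hub_graph_eq:
  assumes "n \<ge> 3" "c < n" "cyc_locating n S" "S \<noteq> {}" "even n \<Longrightarrow> cyc_dominating n S"
    and "card S + 1 \<le> k"
    and "\<And>S a. cyc_locating n S \<Longrightarrow> a \<ge> 1 \<Longrightarrow> (even n \<Longrightarrow> a = 1 \<Longrightarrow> cyc_dominating n S) \<Longrightarrow>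
      k \<le> card S + a"
  shows "metric_dim (hub_graph n c) = k"
proof -
  obtain T where T: "resolving_set (hub_graph n c) T" "finite T" "card T = card S + 1"
    using resolving_hub_graph_exists[OF assms(1-5)] by blast
  have "k \<le> card U" if U: "resolving_set (hub_graph n c) U" "finite U" for U
  proof -
    obtain S a where "cyc_locating n S" "a \<ge> 1" "card U = card S + a"
      "even n \<Longrightarrow> a = 1 \<Longrightarrow> cyc_dominating n S"
      using resolving_hub_graph_lower[OF assms(1,2) U] by blast
    then show ?thesis using assms(7)[of S a] by simp
  qed
  then have "k \<le> metric_dim (hub_graph n c)" by (rule metric_dim_ge[OF T(1,2)])
  with metric_dim_le[OF T(1,2)] T(3) assms(6) show ?thesis by linarith
qed

theorem theorem4p5:
  fixes n :: nat and f\<^sub>0 :: "nat \<Rightarrow> nat"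
  assumes "n \<ge> 3"
    and "f\<^sub>0 \<in> verts (cycle_graph n) \<rightarrow> verts (cycle_graph n)"
    and "\<exists>c. \<forall>u\<in>verts (cycle_graph n). f\<^sub>0 u = c"
  shows "(n = 3 \<longrightarrow> metric_dim (functigraph (cycle_graph n) f\<^sub>0) = 3) \<and>
         (odd n \<and> n \<noteq> 3 \<longrightarrow>
            int (metric_dim (functigraph (cycle_graph n) f\<^sub>0)) = \<lceil>(2 * real n + 3) / 5\<rceil>) \<and>
         (even n \<longrightarrow>
            int (metric_dim (functigraph (cycle_graph n) f\<^sub>0)) = \<lceil>(2 * real n) / 5\<rceil> + 1)"
proof -
  obtain c where c: "\<forall>u\<in>verts (cycle_graph n). f\<^sub>0 u = c" using assms(3) by blast
  have "0 \<in> verts (cycle_graph n)" using assms(1) by (simp add: cycle_graph_def)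
  with c assms(2) have "c \<in> verts (cycle_graph n)" by (metis PiE)
  then have "c < n" by (simp add: cycle_graph_def)
  have graph: "functigraph (cycle_graph n) f\<^sub>0 = hub_graph n c"
    using c unfolding hub_graph_def functigraph_def by (auto intro!: arg_cong2[where f = "(\<union>)"])
  show ?thesis
    unfolding graph
  proof (intro conjI impI)
    assume "n = 3"
    have three: "{..<3::nat} = {0, 1, 2}" by auto
    show "metric_dim (hub_graph n c) = 3"
    proof (rule metric_dim_hub_graph_eq[OF assms(1) \<open>c < n\<close>, where S = "{0, 1}"])
      show "cyc_locating n {0, 1}" using \<open>n = 3\<close> three by (auto simp: cyc_locating_def)
      fix S and a :: nat assume S: "cyc_locating n S" and a: "a \<ge> 1"
      have fin: "finite S" using S finite_subset by (auto simp: cyc_locating_def)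
      \<comment> \<open>In a triangle any two vertices outside \<open>S\<close> look alike, so two
        rim landmarks are needed where the counting bound allows one.\<close>
      have adj: "cyc_adj 3 x s" if "x < 3" "s < 3" "x \<noteq> s" for x s
        using that by (auto simp: cyc_adj_def)
      have "card ({..<3} - S) \<le> 1"
        using S \<open>n = 3\<close> adj
        by (intro card_le_1I) (simp, unfold cyc_locating_def, metis DiffD1 DiffD2 lessThan_iff subsetD)
      moreover have "3 - card S \<le> card ({..<3} - S)"
        using diff_card_le_card_Diff[OF fin, of "{..<3}"] by simp
      ultimately show "3 \<le> card S + a" using a by linarith
    qed (use \<open>n = 3\<close> in auto)
  next
    assume n: "odd n \<and> n \<noteq> 3"
    define k where "k = nat \<lceil>(2 * real n + 3) / 5\<rceil>"
    have k: "int k = \<lceil>(2 * real n + 3) / 5\<rceil>" by (simp add: k_def)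
    then have "real k \<ge> (2 * real n + 3) / 5" "real k < (2 * real n + 3) / 5 + 1"
      by linarith+
    \<comment> \<open>These inequalities characterise the ceiling; \<open>k\<close> is one more than
      the ceiling of (2n - 2) / 5.\<close>
    then have k1: "5 * k \<ge> 2 * n + 3" and k2: "5 * k < 2 * n + 8" by (simp_all add: field_simps)
    have "n \<ge> 5" using n assms(1) by presburger
    then obtain S where S: "cyc_locating n S" "S \<noteq> {}" "5 * card S \<le> 2 * n + 2"
      using exists_cyc_locating by blast
    have "metric_dim (hub_graph n c) = k"
    proof (rule metric_dim_hub_graph_eq[OF assms(1) \<open>c < n\<close> S(1,2)])
      show "card S + 1 \<le> k" using S(3) k1 by linarith
      show "k \<le> card U + a" if "cyc_locating n U" "a \<ge> 1" for U and a :: nat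
        using cyc_locating_card(1)[OF that(1)] that(2) k2 by linarith
    qed (use n in simp)
    with k show "int (metric_dim (hub_graph n c)) = \<lceil>(2 * real n + 3) / 5\<rceil>" by simp
  next
    assume n: "even n"
    define k where "k = nat \<lceil>2 * real n / 5\<rceil>"
    have k: "int k = \<lceil>2 * real n / 5\<rceil>" by (simp add: k_def)
    then have "real k \<ge> 2 * real n / 5" "real k < 2 * real n / 5 + 1"
      by linarith+
    then have k1: "5 * k \<ge> 2 * n" and k2: "5 * k < 2 * n + 5" by (simp_all add: field_simps)
    have "n \<ge> 4" using n assms(1) by presburger
    then obtain S where S: "cyc_locating n S" "cyc_dominating n S" "S \<noteq> {}" "5 * card S \<le> 2 * n + 4"
      using exists_cyc_locating_dominating by blast
    have "metric_dim (hub_graph n c) = k + 1"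
    proof (rule metric_dim_hub_graph_eq[OF assms(1) \<open>c < n\<close> S(1,3)])
      show "cyc_dominating n S" by fact
      show "card S + 1 \<le> k + 1" using S(4) k1 by linarith
      show "k + 1 \<le> card U + a"
        if U: "cyc_locating n U" "a \<ge> 1" "even n \<Longrightarrow> a = 1 \<Longrightarrow> cyc_dominating n U" for U and a :: nat
      proof (cases "a = 1")
        case True
        then show ?thesis using cyc_locating_card(2)[OF U(1)] U(3) n k2 by linarith
      next
        case False
        \<comment> \<open>Dropping domination saves at most one rim landmark, which the further
          landmark in the second copy costs again.\<close>
        then show ?thesis using cyc_locating_card(1)[OF U(1)] U(2) k2 by linarith
      qed
    qed
    with k show "int (metric_dim (hub_graph n c)) = \<lceil>2 * real n / 5\<rceil> + 1" by simp
  qed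
qed

end
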